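(* Let $N\ge 1$ be an integer, let $\beta\ge 0$ be fixed, and let $h>0$. For all $a_1,\dots,a_N>0$ with $\prod_{j=1}^N a_j=h^N$, $$\lambda_1\bigl(\Omega(a_1,\dots,a_N)\bigr)\ \ge\ \lambda_1\bigl(\Omega(h,\dots,h)\bigr).$$ That is, amongst all boxes with a given volume, the cube has the smallest fundamental Robin eigenvalue.
   Context: For $\mathbf a=(a_1,\dots,a_N)$ with all $a_j>0$, the box is $\Omega(\mathbf a)=(-a_1,a_1)\times\cdots\times(-a_N,a_N)\subset\mathbb{R}^N$, with volume $2^N\prod_j a_j$. For given $\beta\ge 0$, $\lambda_1(\Omega)$ denotes the fundamental (smallest) Robin eigenvalue of the Laplacian, i.e. the smallest $\lambda$ for which there is a function $u$, not identically zero, with $\Delta u+\lambda u=0$ in $\Omega$ and $\beta\,\partial u/\partial n+u=0$ on $\partial\Omega$ ($n$ the outward normal). For boxes it is given by the explicit formula $$\lambda_1(\Omega(\mathbf a))=\sum_{j=1}^N\mu(a_j)^2,$$ where, if $\beta>0$, $\mu(c)$ is the unique solution in $(0,\pi/(2c))$ of $\mu\tan(c\mu)=1/\beta$, and, if $\beta=0$, $\mu(c)=\pi/(2c)$. *)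

theory Defs
  imports "HOL-Analysis.Analysis"
begin

text \<open>
  Outward unit normals of a set at a boundary point: to first order at \<open>x\<close> the set is the
  half-space \<open>(y - x) \<bullet> n < 0\<close>. At points where the boundary has no tangent hyperplane (edges
  and corners of a box) there is no such \<open>n\<close>.
\<close>

definition outward_unit_normal :: "'a::euclidean_space set \<Rightarrow> 'a \<Rightarrow> 'a \<Rightarrow> bool" where
  "outward_unit_normal \<Omega> x n \<longleftrightarrow>
     x \<in> frontier \<Omega> \<and> norm n = 1 \<and>
     (\<forall>e>0. \<forall>\<^sub>F y in at x.
        ((y - x) \<bullet> n \<le> - e * norm (y - x) \<longrightarrow> y \<in> \<Omega>) \<and>
        ((y - x) \<bullet> n \<ge> e * norm (y - x) \<longrightarrow> y \<notin> \<Omega>))"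

text \<open>
  Classical solutions, of class \<open>C\<^sup>2\<close> in \<open>\<Omega>\<close> and \<open>C\<^sup>1\<close> up to the boundary, of
  \<open>\<Delta>u + \<Lambda> u = 0\<close> in \<open>\<Omega>\<close> with \<open>\<beta> \<partial>u/\<partial>n + u = 0\<close> at every boundary point that has a normal.
  Here \<open>g\<close> is the gradient of \<open>u\<close>, \<open>H\<close> its second derivative, and the sum is the trace of \<open>H x\<close>,
  that is, \<open>\<Delta>u(x)\<close>. For \<open>\<beta> = 0\<close> the boundary condition is the Dirichlet condition.
\<close>

definition robin_solution ::
    "real \<Rightarrow> 'a::euclidean_space set \<Rightarrow> real \<Rightarrow> ('a \<Rightarrow> real) \<Rightarrow> bool" where
  "robin_solution \<beta> \<Omega> \<Lambda> u \<longleftrightarrow>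
     (\<exists>(g :: 'a \<Rightarrow> 'a) (H :: 'a \<Rightarrow> 'a \<Rightarrow>\<^sub>L 'a).
        (\<forall>x\<in>closure \<Omega>. (u has_derivative (\<lambda>v. g x \<bullet> v)) (at x within closure \<Omega>)) \<and>
        continuous_on (closure \<Omega>) g \<and>
        (\<forall>x\<in>\<Omega>. (g has_derivative blinfun_apply (H x)) (at x)) \<and>
        continuous_on \<Omega> H \<and>
        (\<forall>x\<in>\<Omega>. (\<Sum>b\<in>Basis. blinfun_apply (H x) b \<bullet> b) + \<Lambda> * u x = 0) \<and>
        (\<forall>x n. outward_unit_normal \<Omega> x n \<longrightarrow> \<beta> * (g x \<bullet> n) + u x = 0))"

definition robin_eigenvalue :: "real \<Rightarrow> 'a::euclidean_space set \<Rightarrow> real \<Rightarrow> bool" where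
  "robin_eigenvalue \<beta> \<Omega> \<Lambda> \<longleftrightarrow> (\<exists>u. robin_solution \<beta> \<Omega> \<Lambda> u \<and> (\<exists>x\<in>\<Omega>. u x \<noteq> 0))"

definition robin_lambda1 :: "real \<Rightarrow> 'a::euclidean_space set \<Rightarrow> real" where
  "robin_lambda1 \<beta> \<Omega> = (LEAST \<Lambda>. robin_eigenvalue \<beta> \<Omega> \<Lambda>)"

definition centered_box :: "real ^ 'n \<Rightarrow> (real ^ 'n) set" where
  "centered_box a = {x. \<forall>j. - (a $ j) < x $ j \<and> x $ j < a $ j}"

end

theory Submission
  imports Defs
begin

text \<open>
  The fundamental eigenvalue of the box is a sum of one-dimensional contributions,
  \<open>robin_lambda1 \<beta> (centered_box a) = \<Sum>\<mu>(a\<^sub>j)\<^sup>2\<close> (lemma \<open>robin_lambda1_box\<close>), and the squared frequency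
  \<open>\<mu>(c)\<^sup>2\<close> is a convex function of \<open>ln c\<close> (lemma \<open>robin_freq_tangent\<close>). Fixing the volume fixes the sum of
  the \<open>ln a\<^sub>j\<close>, so by Jensen's inequality, here summation of the supporting line at \<open>ln h\<close>, the cube is
  optimal.

  The eigenvalue formula has two halves. The product of the functions \<open>cos (\<mu>(a\<^sub>j) x\<^sub>j)\<close> is an
  eigenfunction (\<open>robin_eigenvalue_cos_prod\<close>). That no eigenvalue is smaller (\<open>robin_eigenvalue_ge\<close>)
  follows from a maximum principle instead of a variational characterisation, which suits the
  classical notion of solution: a product of cosines with slightly smaller frequencies is a strict
  positive supersolution, and a solution \<open>u\<close> for a smaller \<open>\<Lambda>\<close> divided by it can have a positive
  maximum neither inside the box nor on the boundary (\<open>robin_solution_nonpos\<close>).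

  For the convexity when \<open>\<beta> > 0\<close>, \<open>x = c \<mu>(c)\<close> parametrises the curve: \<open>\<beta> \<mu> = cot x\<close> and
  \<open>c = \<beta> x tan x\<close>. The slope of \<open>\<mu>\<^sup>2\<close> against \<open>ln c\<close> is then \<open>- 2 / (\<beta>\<^sup>2 log_cot_ratio x)\<close>, and
  \<open>log_cot_ratio\<close> is increasing.
\<close>

section \<open>Frequencies of the interval\<close>

text \<open>
  The equation \<open>\<mu> tan (c \<mu>) = 1 / \<beta>\<close>, cleared of denominators so that \<open>\<beta> = 0\<close> is included: there it
  reads \<open>cos (c \<mu>) = 0\<close> and gives \<open>\<mu> = pi / (2 c)\<close>.
\<close>

definition robin_freq :: "real \<Rightarrow> real \<Rightarrow> real \<Rightarrow> bool" where
  "robin_freq \<beta> c m \<longleftrightarrow> 0 < m \<and> m * c \<le> pi / 2 \<and> cos (m * c) = \<beta> * m * sin (m * c)"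

lemma robin_freq_exists:
  assumes "\<beta> \<ge> 0" "c > 0"
  shows "\<exists>m. robin_freq \<beta> c m"
proof -
  let ?f = "\<lambda>m. cos (m * c) - \<beta> * m * sin (m * c)"
  have "\<exists>m\<ge>0. m \<le> pi / (2 * c) \<and> ?f m = 0"
  proof (rule IVT2')
    show "?f (pi / (2 * c)) \<le> 0"
      using assms by simp
    show "0 \<le> ?f 0" by simp
    show "0 \<le> pi / (2 * c)" using assms by simp
    show "continuous_on {0..pi / (2 * c)} ?f" by (intro continuous_intros)
  qed
  then obtain m where m: "0 \<le> m" "m \<le> pi / (2 * c)" "?f m = 0" by blast
  moreover have "m \<noteq> 0" using m(3) by auto
  moreover have "m * c \<le> pi / 2" using m(2) assms(2) by (simp add: field_simps)
  ultimately show ?thesis unfolding robin_freq_def by (intro exI[of _ m]) auto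
qed

text \<open>
  For \<open>n\<close> below the frequency, \<open>w x = cos (n x)\<close> satisfies the boundary condition at \<open>x = c\<close> with a
  strict sign, \<open>\<beta> w' c + w c > 0\<close>, so that it can serve as a strict supersolution.
\<close>

lemma robin_defect_pos:
  assumes "\<beta> \<ge> 0" "c > 0" "robin_freq \<beta> c m" "0 \<le> n" "n < m"
  shows "\<beta> * n * sin (n * c) < cos (n * c)"
proof -
  have m: "m * c \<le> pi / 2" "cos (m * c) = \<beta> * m * sin (m * c)"
    using assms(3) by (auto simp: robin_freq_def)
  have nc: "0 \<le> n * c" "n * c < m * c" using assms by auto
  have "sin (n * c) \<le> sin (m * c)" using nc m by (intro sin_monotone_2pi_le) auto
  moreover have "0 \<le> sin (n * c)" using nc m by (intro sin_ge_zero) auto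
  ultimately have "\<beta> * n * sin (n * c) \<le> \<beta> * m * sin (m * c)"
    using assms by (intro mult_mono) auto
  also have "\<dots> = cos (m * c)" using m by simp
  also have "\<dots> < cos (n * c)" using nc m by (intro cos_monotone_0_pi) auto
  finally show ?thesis .
qed

section \<open>Convexity of the squared frequency in the logarithm of the length\<close>

lemma tan_over_id_mono:
  assumes "0 < x" "x \<le> y" "y < pi / 2"
  shows "tan x / x \<le> tan y / y"
proof (rule DERIV_nonneg_imp_nondecreasing[OF assms(2)])
  fix z assume z: "x \<le> z" "z \<le> y"
  have c: "0 < cos z" using z assms by (intro cos_gt_zero_pi) auto
  have s: "0 < sin z" using z assms by (intro sin_gt_zero) auto
  have "sin z * cos z \<le> sin z" using s c by (simp add: mult_left_le)
  also have "\<dots> \<le> z" using z assms by (intro sin_x_le_x) auto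
  finally have le: "sin z * cos z \<le> z" .
  have "((\<lambda>z. tan z / z) has_real_derivative
      (inverse ((cos z)\<^sup>2) * z - tan z) / z\<^sup>2) (at z)"
    using c z assms by (auto intro!: derivative_eq_intros simp: power2_eq_square)
  moreover have "inverse ((cos z)\<^sup>2) * z - tan z = (z - sin z * cos z) / (cos z)\<^sup>2"
    using c by (simp add: tan_def field_simps power2_eq_square)
  hence "0 \<le> (inverse ((cos z)\<^sup>2) * z - tan z) / z\<^sup>2" using le by simp
  ultimately show "\<exists>d. ((\<lambda>z. tan z / z) has_real_derivative d) (at z) \<and> 0 \<le> d" by blast
qed

text \<open>
  The quotient of the derivatives of \<open>ln (x tan x)\<close> and of \<open>- (cot x)\<^sup>2 / 2\<close>. It is written as a
  combination of \<open>tan x\<close>, \<open>tan x / x\<close> and \<open>sin x\<close> because each of these is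
  positive and increasing on \<open>(0, pi / 2)\<close>.
\<close>

definition log_cot_ratio :: "real \<Rightarrow> real" where
  "log_cot_ratio x = (tan x)\<^sup>2 + tan x / x * (sin x)\<^sup>2"

lemma log_cot_ratio_pos:
  assumes "0 < x" "x < pi / 2"
  shows "0 < log_cot_ratio x"
  unfolding log_cot_ratio_def using assms tan_gt_zero[of x] by (intro add_pos_nonneg) auto

lemma log_cot_ratio_mono:
  assumes "0 < x" "x \<le> y" "y < pi / 2"
  shows "log_cot_ratio x \<le> log_cot_ratio y"
proof -
  have s: "0 < sin x" "sin x \<le> sin y"
    using assms by (auto intro!: sin_gt_zero sin_monotone_2pi_le)
  have t: "0 < tan x" "tan x \<le> tan y"
    using assms by (auto intro!: tan_gt_zero tan_mono_le)
  show ?thesis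
    unfolding log_cot_ratio_def
    using s t tan_over_id_mono[OF assms] assms(1,2)
    by (intro add_mono mult_mono power_mono) auto
qed

text \<open>
  With \<open>x = c \<mu>\<close>, the condition \<open>\<mu> tan (c \<mu>) = 1 / \<beta>\<close> says \<open>\<beta> \<mu> = cot x\<close> and \<open>c = \<beta> x tan x\<close>. Up to
  scaling and an additive constant, \<open>cot_log\<close> is therefore \<open>\<mu>\<^sup>2\<close> minus a linear function of \<open>ln c\<close> on
  this curve.
\<close>

definition cot_log :: "real \<Rightarrow> real \<Rightarrow> real" where
  "cot_log k x = (inverse (tan x))\<^sup>2 + 2 * k * (ln x + ln (tan x))"

text \<open>
  The derivative of \<open>cot_log k\<close> is a positive multiple of \<open>k * log_cot_ratio z - 1\<close>. As
  \<open>log_cot_ratio\<close> is increasing, the derivative is nonpositive before \<open>x\<close> and nonnegative after it for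
  the value of \<open>k\<close> that makes it vanish at \<open>x\<close>.
\<close>

lemma cot_log_min:
  fixes x y :: real
  assumes x: "0 < x" "x < pi / 2" and y: "0 < y" "y < pi / 2"
    and k: "k = inverse (log_cot_ratio x)"
  shows "cot_log k x \<le> cot_log k y"
proof -
  define d where "d z = 2 * (k * log_cot_ratio z - 1) * (cos z / sin z ^ 3)" for z
  have der: "(cot_log k has_real_derivative d z) (at z)" if z: "0 < z" "z < pi/2" for z
  proof -
    have c: "0 < cos z" using z by (intro cos_gt_zero_pi) auto
    have s: "0 < sin z" using z by (intro sin_gt_zero) auto
    have t: "0 < tan z" using z by (intro tan_gt_zero)
    have "(cot_log k has_real_derivative
        (2 * inverse (tan z) * (- (inverse (tan z) * inverse ((cos z)\<^sup>2) * inverse (tan z)))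
         + 2 * k * (1 / z + inverse ((cos z)\<^sup>2) / tan z))) (at z)"
      unfolding cot_log_def
      by (rule derivative_eq_intros refl | use c s t z in force)+
    moreover have "2 * inverse (tan z) * (- (inverse (tan z) * inverse ((cos z)\<^sup>2) * inverse (tan z)))
         + 2 * k * (1 / z + inverse ((cos z)\<^sup>2) / tan z) = d z"
      unfolding d_def log_cot_ratio_def tan_def using c s z
      by (simp add: divide_simps power2_eq_square power3_eq_cube) (simp add: algebra_simps)
    ultimately show ?thesis by simp
  qed
  have pos: "0 \<le> cos z / sin z ^ 3" if "0 < z" "z < pi/2" for z
    using that cos_gt_zero_pi[of z] sin_gt_zero[of z] by auto
  have kq: "k * log_cot_ratio x = 1" "k > 0" using log_cot_ratio_pos[OF x] k by auto
  show ?thesis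
  proof (cases "x \<le> y")
    case True
    show ?thesis
    proof (rule DERIV_nonneg_imp_nondecreasing[OF True])
      fix z assume z: "x \<le> z" "z \<le> y"
      have "k * log_cot_ratio x \<le> k * log_cot_ratio z"
        using log_cot_ratio_mono[of x z] z x y kq(2) by (intro mult_left_mono) auto
      hence "0 \<le> d z" using kq pos[of z] z x y unfolding d_def by (intro mult_nonneg_nonneg) auto
      thus "\<exists>l. (cot_log k has_real_derivative l) (at z) \<and> 0 \<le> l" using der[of z] z x y by (intro exI[of _ "d z"]) auto
    qed
  next
    case False
    hence yx: "y \<le> x" by simp
    show ?thesis
    proof (rule DERIV_nonpos_imp_nonincreasing[OF yx])
      fix z assume z: "y \<le> z" "z \<le> x"
      have "k * log_cot_ratio z \<le> k * log_cot_ratio x"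
        using log_cot_ratio_mono[of z x] z x y kq(2) by (intro mult_left_mono) auto
      hence "d z \<le> 0" using kq pos[of z] z x y unfolding d_def by (intro mult_nonpos_nonneg[of "2 * _"]) auto
      thus "\<exists>l. (cot_log k has_real_derivative l) (at z) \<and> l \<le> 0" using der[of z] z x y by (intro exI[of _ "d z"]) auto
    qed
  qed
qed

text \<open>
  The squared frequency, as a function of \<open>ln c\<close>, has a supporting line at \<open>ln h\<close>. For \<open>\<beta> = 0\<close> the
  function is the exponential \<open>m\<^sup>2 exp (2 (ln h - ln c))\<close> and \<open>exp x \<ge> 1 + x\<close> suffices; for \<open>\<beta> > 0\<close>
  the line comes from the minimum of \<open>cot_log\<close>, through the parameter \<open>n c\<close>.
\<close>

lemma robin_freq_tangent:
  assumes b: "\<beta> \<ge> 0" and h: "h > 0" and fh: "robin_freq \<beta> h m"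
  shows "\<exists>k. \<forall>c n. c > 0 \<longrightarrow> robin_freq \<beta> c n \<longrightarrow> n\<^sup>2 \<ge> m\<^sup>2 - k * (ln c - ln h)"
proof (cases "\<beta> = 0")
  case True
  have m: "n = pi / (2 * c)" if "robin_freq \<beta> c n" "c > 0" for c n
  proof -
    have n: "0 < n" "n * c \<le> pi/2" "cos (n * c) = 0" using that True by (auto simp: robin_freq_def)
    have "0 < n * c" using n that by simp
    hence "\<not> n * c < pi / 2" using cos_gt_zero_pi[of "n * c"] n(3) by force
    hence "n * c = pi / 2" using n(2) by linarith
    thus ?thesis using that by (simp add: field_simps)
  qed
  show ?thesis
  proof (intro exI[of _ "2 * m\<^sup>2"] allI impI)
    fix c n assume c: "(c::real) > 0" "robin_freq \<beta> c n"
    have "n = m * (h / c)" using m[OF c(2,1)] m[OF fh h] c h by simp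
    moreover have "h / c = exp (ln h - ln c)" using c h by (simp add: exp_diff)
    ultimately have "n\<^sup>2 = m\<^sup>2 * exp (2 * (ln h - ln c))"
      by (simp only: power_mult_distrib exp_double)
    also have "\<dots> \<ge> m\<^sup>2 * (1 + 2 * (ln h - ln c))"
      by (intro mult_left_mono exp_ge_add_one_self) auto
    finally show "m\<^sup>2 - 2 * m\<^sup>2 * (ln c - ln h) \<le> n\<^sup>2" by (simp add: algebra_simps)
  qed
next
  case False
  hence b: "\<beta> > 0" using b by simp
  have par: "\<exists>t. 0 < t \<and> t < pi / 2 \<and> n\<^sup>2 = (inverse (tan t))\<^sup>2 / \<beta>\<^sup>2 \<and>
      ln c = ln \<beta> + (ln t + ln (tan t))" if fr: "robin_freq \<beta> c n" and c: "c > 0" for c n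
  proof (intro exI conjI)
    define t where "t = n * c"
    have n: "0 < n" "t \<le> pi/2" "cos t = \<beta> * n * sin t"
      using fr by (auto simp: robin_freq_def t_def)
    show t0: "0 < t" using n c by (simp add: t_def)
    have s: "0 < sin t" using t0 n by (intro sin_gt_zero) auto
    have co: "0 < cos t" using n s b by simp
    show t1: "t < pi / 2" using co n(2) by (cases "t = pi / 2") auto
    have T: "0 < tan t" using t0 t1 by (rule tan_gt_zero)
    have bn: "\<beta> * n * tan t = 1" using n(1,3) b s by (simp add: tan_def)
    have nn: "n = inverse (tan t) / \<beta>" using bn T b by (simp add: field_simps)
    show "n\<^sup>2 = (inverse (tan t))\<^sup>2 / \<beta>\<^sup>2" by (subst nn) (rule power_divide)
    have "\<beta> * (t * tan t) = c * (\<beta> * n * tan t)" by (simp add: t_def)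
    hence "c = \<beta> * (t * tan t)" unfolding bn by simp
    thus "ln c = ln \<beta> + (ln t + ln (tan t))" using b t0 T by (simp add: ln_mult_pos)
  qed
  obtain x where x: "0 < x" "x < pi / 2" "m\<^sup>2 = (inverse (tan x))\<^sup>2 / \<beta>\<^sup>2"
      "ln h = ln \<beta> + (ln x + ln (tan x))"
    using par[OF fh h] by blast
  define k where "k = inverse (log_cot_ratio x)"
  show ?thesis
  proof (intro exI[of _ "2 * k / \<beta>\<^sup>2"] allI impI)
    fix c n assume c: "(c::real) > 0" "robin_freq \<beta> c n"
    obtain y where y: "0 < y" "y < pi / 2" "n\<^sup>2 = (inverse (tan y))\<^sup>2 / \<beta>\<^sup>2"
        "ln c = ln \<beta> + (ln y + ln (tan y))"
      using par[OF c(2,1)] by blast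
    have "cot_log k x \<le> cot_log k y"
      by (rule cot_log_min[OF x(1,2) y(1,2) k_def])
    hence "(inverse (tan x))\<^sup>2 - 2 * k * (ln c - ln h) \<le> (inverse (tan y))\<^sup>2"
      unfolding x(4) y(4) by (simp add: cot_log_def algebra_simps)
    hence "((inverse (tan x))\<^sup>2 - 2 * k * (ln c - ln h)) / \<beta>\<^sup>2 \<le> (inverse (tan y))\<^sup>2 / \<beta>\<^sup>2"
      by (rule divide_right_mono) auto
    thus "m\<^sup>2 - 2 * k / \<beta>\<^sup>2 * (ln c - ln h) \<le> n\<^sup>2"
      unfolding x(3) y(3) by (simp add: diff_divide_distrib)
  qed
qed

section \<open>Products of cosines\<close>

text \<open>
  The gradient of a product of functions of single coordinates has components of the same product
  form, with one factor replaced by its derivative. Hence the lemma can be applied to its own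
  result to get the second derivative.
\<close>

lemma has_derivative_prod_coordinates:
  fixes f f' :: "'n::finite \<Rightarrow> real \<Rightarrow> real" and x :: "real ^ 'n"
  assumes "\<And>k. (f k has_real_derivative f' k (x $ k)) (at (x $ k))"
  shows "((\<lambda>x. \<Prod>k\<in>UNIV. f k (x $ k)) has_derivative
          (\<lambda>v. (\<chi> k. \<Prod>l\<in>UNIV. (f(k := f' k)) l (x $ l)) \<bullet> v)) (at x)"
proof -
  have 1: "((\<lambda>x. f k (x $ k)) has_derivative (\<lambda>v. f' k (x $ k) * (v $ k))) (at x)" for k
  proof -
    have "((\<lambda>x. x $ k) has_derivative (\<lambda>v. v $ k)) (at x)"
      by (intro bounded_linear_imp_has_derivative bounded_linear_vec_nth)
    from has_derivative_compose[OF this assms[of k, unfolded has_field_derivative_def]]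
    show ?thesis by simp
  qed
  have eq: "(\<Prod>l\<in>UNIV. (f(k := f' k)) l (x $ l)) = f' k (x $ k) * (\<Prod>l\<in>UNIV - {k}. f l (x $ l))" for k
    by (subst prod.remove[of _ k]) (auto intro!: prod.cong)
  from has_derivative_prod[of UNIV "\<lambda>k x. f k (x $ k)", OF 1]
  show ?thesis
    unfolding inner_vec_def vec_lambda_beta eq by (simp add: mult_ac)
qed

definition cos_factor :: "real ^ 'n \<Rightarrow> 'n \<Rightarrow> real \<Rightarrow> real" where
  "cos_factor \<nu> k t = cos (\<nu> $ k * t)"

definition cos_factor1 :: "real ^ 'n \<Rightarrow> 'n \<Rightarrow> real \<Rightarrow> real" where
  "cos_factor1 \<nu> k t = - \<nu> $ k * sin (\<nu> $ k * t)"

definition cos_factor2 :: "real ^ 'n \<Rightarrow> 'n \<Rightarrow> real \<Rightarrow> real" where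
  "cos_factor2 \<nu> k t = - (\<nu> $ k)\<^sup>2 * cos (\<nu> $ k * t)"

definition cos_prod :: "real ^ 'n \<Rightarrow> real ^ 'n \<Rightarrow> real" where
  "cos_prod \<nu> x = (\<Prod>k\<in>UNIV. cos_factor \<nu> k (x $ k))"

definition cos_prod_grad :: "real ^ 'n \<Rightarrow> real ^ 'n \<Rightarrow> real ^ 'n" where
  "cos_prod_grad \<nu> x = (\<chi> k. \<Prod>l\<in>UNIV. ((cos_factor \<nu>)(k := cos_factor1 \<nu> k)) l (x $ l))"

definition cos_prod_hess :: "real ^ 'n \<Rightarrow> real ^ 'n \<Rightarrow> (real ^ 'n) \<Rightarrow>\<^sub>L (real ^ 'n)" where
  "cos_prod_hess \<nu> x = Blinfun (frechet_derivative (cos_prod_grad \<nu>) (at x))"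

lemma cos_factor_derivs:
  "(cos_factor \<nu> k has_real_derivative cos_factor1 \<nu> k t) (at t)"
  "(cos_factor1 \<nu> k has_real_derivative cos_factor2 \<nu> k t) (at t)"
  unfolding cos_factor_def cos_factor1_def cos_factor2_def
  by (auto intro!: derivative_eq_intros simp: power2_eq_square)

lemma has_derivative_cos_prod:
  "(cos_prod \<nu> has_derivative (\<lambda>v. cos_prod_grad \<nu> x \<bullet> v)) (at x)"
  unfolding cos_prod_def cos_prod_grad_def
  by (rule has_derivative_prod_coordinates) (rule cos_factor_derivs)

lemma has_derivative_cos_prod_grad:
  "(cos_prod_grad \<nu> has_derivative (\<lambda>v. \<chi> k.
     (\<chi> m. \<Prod>l\<in>UNIV. ((cos_factor \<nu>)(k := cos_factor1 \<nu> k, m := if m = k then cos_factor2 \<nu> k else cos_factor1 \<nu> m)) l (x $ l)) \<bullet> v)) (at x)"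
proof -
  have "((\<lambda>x. cos_prod_grad \<nu> x $ k) has_derivative (\<lambda>v.
     (\<chi> m. \<Prod>l\<in>UNIV. ((cos_factor \<nu>)(k := cos_factor1 \<nu> k, m := if m = k then cos_factor2 \<nu> k else cos_factor1 \<nu> m)) l (x $ l)) \<bullet> v)) (at x)" for k
    unfolding cos_prod_grad_def vec_lambda_beta
    by (rule has_derivative_prod_coordinates[where f' = "\<lambda>m. if m = k then cos_factor2 \<nu> k else cos_factor1 \<nu> m"])
      (auto intro: cos_factor_derivs)
  thus ?thesis
    by (subst has_derivative_componentwise_within)
       (auto simp: Basis_vec_def inner_axis)
qed

lemma blinfun_apply_cos_prod_hess:
  "blinfun_apply (cos_prod_hess \<nu> x) = (\<lambda>v. \<chi> k.
     (\<chi> m. \<Prod>l\<in>UNIV. ((cos_factor \<nu>)(k := cos_factor1 \<nu> k, m := if m = k then cos_factor2 \<nu> k else cos_factor1 \<nu> m)) l (x $ l)) \<bullet> v)"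
  unfolding cos_prod_hess_def
    frechet_derivative_at[OF has_derivative_cos_prod_grad, symmetric]
  by (rule bounded_linear_Blinfun_apply)
     (rule has_derivative_bounded_linear[OF has_derivative_cos_prod_grad])

lemma continuous_on_cos_prod_hess:
  fixes \<nu> :: "real ^ 'n"
  shows "continuous_on S (cos_prod_hess \<nu>)"
proof (rule continuous_on_blinfun_componentwise)
  fix i :: "real ^ 'n"
  have "continuous_on S (\<lambda>x. ((cos_factor \<nu>)(k := cos_factor1 \<nu> k, m := if m = k then cos_factor2 \<nu> k else cos_factor1 \<nu> m)) l (x $ l))" for k m l
    by (auto simp: cos_factor_def cos_factor1_def cos_factor2_def[abs_def] intro!: continuous_intros)
  thus "continuous_on S (\<lambda>x. blinfun_apply (cos_prod_hess \<nu> x) i)"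
    unfolding blinfun_apply_cos_prod_hess
    by (intro continuous_on_vec_lambda continuous_on_inner continuous_on_const continuous_on_prod)
qed

lemma sum_Basis_cart:
  fixes f :: "real ^ 'n \<Rightarrow> real"
  shows "(\<Sum>b\<in>Basis. f b) = (\<Sum>k\<in>UNIV. f (axis k 1))"
proof -
  have 1: "(Basis :: (real ^ 'n) set) = range (\<lambda>k. axis k 1)" by (auto simp: Basis_vec_def)
  have 2: "inj (\<lambda>k::'n. axis k (1::real))" by (auto simp: inj_on_def axis_eq_axis)
  show ?thesis unfolding 1 by (subst sum.reindex[OF 2]) (simp add: o_def)
qed

lemma cos_prod_hess_diag:
  "blinfun_apply (cos_prod_hess \<nu> x) (axis k 1) \<bullet> axis k 1 = - (\<nu> $ k)\<^sup>2 * cos_prod \<nu> x"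
proof -
  have "(\<Prod>l\<in>UNIV. ((cos_factor \<nu>)(k := cos_factor2 \<nu> k)) l (x $ l)) = - (\<nu> $ k)\<^sup>2 * cos_prod \<nu> x"
    unfolding cos_prod_def
    by (subst (1 2) prod.remove[of _ k]) (auto simp: cos_factor2_def cos_factor_def intro!: prod.cong)
  thus ?thesis by (simp only: blinfun_apply_cos_prod_hess inner_axis vec_lambda_beta fun_upd_upd if_True simp_thms) simp
qed

text \<open>
  Isolating the \<open>k\<close>-th factor reduces the boundary condition on the faces orthogonal to the
  \<open>k\<close>-th axis to a relation between \<open>cos\<close> and \<open>sin\<close> at the end of an interval.
\<close>

lemma cos_prod_split:
  "cos_prod_grad \<nu> x $ k = - \<nu> $ k * sin (\<nu> $ k * x $ k) * (\<Prod>l\<in>UNIV-{k}. cos (\<nu> $ l * x $ l))"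
  "cos_prod \<nu> x = cos (\<nu> $ k * x $ k) * (\<Prod>l\<in>UNIV-{k}. cos (\<nu> $ l * x $ l))"
proof -
  show "cos_prod_grad \<nu> x $ k = - \<nu> $ k * sin (\<nu> $ k * x $ k) * (\<Prod>l\<in>UNIV-{k}. cos (\<nu> $ l * x $ l))"
    unfolding cos_prod_grad_def
    by (simp, subst prod.remove[of _ k]) (auto simp: cos_factor1_def cos_factor_def intro!: prod.cong)
  show "cos_prod \<nu> x = cos (\<nu> $ k * x $ k) * (\<Prod>l\<in>UNIV-{k}. cos (\<nu> $ l * x $ l))"
    unfolding cos_prod_def
    by (subst prod.remove[of _ k]) (auto simp: cos_factor_def)
qed

lemma continuous_on_cos_prod_grad: "continuous_on S (cos_prod_grad \<nu>)"
  using has_derivative_cos_prod_grad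
  by (meson continuous_at_imp_continuous_on has_derivative_continuous)

section \<open>Boxes and their normals\<close>

lemma centered_box_eq: "centered_box a = box (- a) a"
  by (auto simp: centered_box_def mem_box_cart)

lemma centered_box_facts:
  assumes "\<And>j. a $ j > 0"
  shows "open (centered_box a)" "closure (centered_box a) = cbox (- a) a"
    "frontier (centered_box a) = cbox (- a) a - box (- a) a" "0 \<in> centered_box a"
proof -
  show 0: "0 \<in> centered_box a" using assms by (simp add: centered_box_def)
  hence "box (- a) a \<noteq> {}" unfolding centered_box_eq by blast
  thus "closure (centered_box a) = cbox (- a) a"
    "frontier (centered_box a) = cbox (- a) a - box (- a) a"
    unfolding centered_box_eq by (simp_all add: frontier_box)
  show "open (centered_box a)" unfolding centered_box_eq by (rule open_box)
qed

lemma cbox_sym_cart: "x \<in> cbox (- a) a \<longleftrightarrow> (\<forall>k. \<bar>x $ k\<bar> \<le> a $ k)"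
  for x a :: "real ^ 'n"
  by (auto simp: mem_box_cart abs_le_iff minus_le_iff)

lemma outward_unit_normal_face:
  fixes a :: "real ^ 'n"
  assumes a: "\<And>j. a $ j > 0" and s: "s = 1 \<or> s = -1"
    and xj: "x $ j = s * a $ j" and xk: "\<And>k. k \<noteq> j \<Longrightarrow> \<bar>x $ k\<bar> < a $ k"
  shows "outward_unit_normal (centered_box a) x (axis j s)"
  unfolding outward_unit_normal_def
proof (intro conjI allI impI)
  have "x \<notin> centered_box a" using xj s a by (auto simp: centered_box_def intro!: exI[of _ j])
  moreover have "\<bar>x $ k\<bar> \<le> a $ k" for k
    using xk[of k] xj s a[of j] by (cases "k = j") auto
  hence "x \<in> cbox (- a) a" by (auto simp: mem_box_cart abs_le_iff minus_le_iff)
  ultimately show "x \<in> frontier (centered_box a)"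
    using centered_box_facts[OF a] by (auto simp: centered_box_eq)
  show "norm (axis j s) = 1" using s by (auto simp: norm_eq_sqrt_inner inner_axis_axis)
  fix e :: real assume e: "e > 0"
  let ?U = "{y. (\<forall>k. k \<noteq> j \<longrightarrow> \<bar>y $ k\<bar> < a $ k) \<and> 0 < s * y $ j}"
  have "?U = (\<Inter>k. {y. k \<noteq> j \<longrightarrow> \<bar>y $ k\<bar> < a $ k}) \<inter> {y. 0 < s * y $ j}" by auto
  moreover have "open {y::real^'n. k \<noteq> j \<longrightarrow> \<bar>y $ k\<bar> < a $ k}" for k
    by (cases "k = j") (auto intro!: open_Collect_less continuous_intros)
  moreover have "open {y::real^'n. 0 < s * y $ j}" 
    by (intro open_Collect_less continuous_intros)
  ultimately have "open ?U" by (auto intro!: open_INT)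
  moreover have "x \<in> ?U" using xk xj s a[of j] by auto
  ultimately have "\<forall>\<^sub>F y in at x. y \<in> ?U" by (rule eventually_at_in_open')
  moreover have "\<forall>\<^sub>F y in at x. y \<noteq> x" by (simp add: eventually_at_filter)
  ultimately show "\<forall>\<^sub>F y in at x.
        ((y - x) \<bullet> axis j s \<le> - e * norm (y - x) \<longrightarrow> y \<in> centered_box a) \<and>
        ((y - x) \<bullet> axis j s \<ge> e * norm (y - x) \<longrightarrow> y \<notin> centered_box a)"
  proof eventually_elim
    case (elim y)
    have n: "0 < e * norm (y - x)" using elim e by simp
    have ip: "(y - x) \<bullet> axis j s = s * y $ j - a $ j"
      using xj s by (auto simp: inner_axis algebra_simps)
    show ?case
    proof (intro conjI impI)
      assume "(y - x) \<bullet> axis j s \<le> - e * norm (y - x)"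
      hence "s * y $ j < a $ j" using n ip by simp
      hence "\<bar>y $ j\<bar> < a $ j" using elim s by auto
      hence "\<bar>y $ k\<bar> < a $ k" for k using elim by (cases "k = j") auto
      thus "y \<in> centered_box a" by (auto simp: centered_box_def abs_less_iff minus_less_iff)
    next
      assume "(y - x) \<bullet> axis j s \<ge> e * norm (y - x)"
      hence "s * y $ j > a $ j" using n ip by simp
      thus "y \<notin> centered_box a" using s by (auto simp: centered_box_def intro!: exI[of _ j])
    qed
  qed
qed

text \<open>
  A normal \<open>n\<close> at a point \<open>x\<close> of the boundary makes every direction \<open>v\<close> with \<open>v \<bullet> n < 0\<close> point into
  the box, hence away from each face through \<open>x\<close>. If \<open>m\<close> is the normal of such a face, the direction
  \<open>v = m - n\<close> is a counterexample unless \<open>n = m\<close>, because both vectors have norm 1.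
\<close>

lemma outward_unit_normal_box:
  fixes a :: "real ^ 'n"
  assumes a: "\<And>j. a $ j > 0" and n: "outward_unit_normal (centered_box a) x n"
  obtains j s where "s = 1 \<or> s = -1" "x $ j = s * a $ j" "n = axis j s"
proof -
  have fr: "x \<in> cbox (- a) a - box (- a) a"
    using n centered_box_facts[OF a] by (auto simp: outward_unit_normal_def)
  then obtain j where j: "\<not> (- a $ j < x $ j \<and> x $ j < a $ j)" 
    by (auto simp: mem_box_cart)
  moreover have "- a $ j \<le> x $ j \<and> x $ j \<le> a $ j" using fr by (auto simp: mem_box_cart)
  ultimately obtain s :: real where s: "s = 1 \<or> s = -1" "x $ j = s * a $ j"
    by (metis mult_1 mult_minus1 order_le_less)
  have neg: "s * v $ j < 0" if v: "v \<bullet> n < 0" for v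
  proof -
    have v0: "v \<noteq> 0" using v by auto
    define e where "e = - (v \<bullet> n) / norm v"
    have e: "e > 0" using v v0 by (simp add: e_def divide_neg_pos)
    have "\<forall>\<^sub>F y in at x. ((y - x) \<bullet> n \<le> - e * norm (y - x) \<longrightarrow> y \<in> centered_box a)"
      using n e by (auto simp: outward_unit_normal_def elim!: eventually_mono)
    then obtain d where d: "d > 0"
      "\<And>y. y \<noteq> x \<Longrightarrow> dist y x < d \<Longrightarrow> (y - x) \<bullet> n \<le> - e * norm (y - x) \<Longrightarrow> y \<in> centered_box a"
      unfolding eventually_at by auto
    define t where "t = d / (2 * norm v)"
    have t: "t > 0" using d v0 by (simp add: t_def)
    have "x + t *\<^sub>R v \<in> centered_box a"
    proof (rule d(2))
      show "x + t *\<^sub>R v \<noteq> x" using t v0 by simp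
      show "dist (x + t *\<^sub>R v) x < d" using d v0 by (simp add: dist_norm t_def)
      show "(x + t *\<^sub>R v - x) \<bullet> n \<le> - e * norm (x + t *\<^sub>R v - x)"
        using t v0 by (simp add: e_def)
    qed
    hence "- a $ j < x $ j + t * v $ j \<and> x $ j + t * v $ j < a $ j"
      by (auto simp: centered_box_def)
    hence "t * (s * v $ j) < 0" using s by auto
    thus ?thesis using t by (simp add: mult_less_0_iff)
  qed
  have nn: "norm n = 1" using n by (simp add: outward_unit_normal_def)
  have "n = axis j s"
  proof (rule ccontr)
    assume ne: "n \<noteq> axis j s"
    have na: "axis j s \<bullet> axis j s = 1" using s by (auto simp: inner_axis_axis)
    have ni: "n \<bullet> n = 1" using nn by (simp add: dot_square_norm)
    have "0 < (axis j s - n) \<bullet> (axis j s - n)" using ne by simp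
    also have "\<dots> = 2 - 2 * (axis j s \<bullet> n)"
      by (simp only: inner_diff_left inner_diff_right inner_commute[of n "axis j s"] ni na)
    finally have lt: "axis j s \<bullet> n < 1" by simp
    hence "(axis j s - n) \<bullet> n < 0" using ni by (simp add: inner_diff_left)
    from neg[OF this] have "s * s - s * n $ j < 0" by (simp add: algebra_simps)
    moreover have "axis j s \<bullet> n = s * n $ j" by (simp add: inner_axis')
    ultimately show False using lt s by auto
  qed
  with s that show ?thesis by blast
qed

section \<open>The ground state\<close>

lemma robin_eigenvalue_cos_prod:
  fixes a m :: "real ^ 'n"
  assumes a: "\<And>j. a $ j > 0" and m: "\<And>j. robin_freq \<beta> (a $ j) (m $ j)"
  shows "robin_eigenvalue \<beta> (centered_box a) (\<Sum>j\<in>UNIV. (m $ j)\<^sup>2)"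
proof -
  have "robin_solution \<beta> (centered_box a) (\<Sum>j\<in>UNIV. (m $ j)\<^sup>2) (cos_prod m)"
    unfolding robin_solution_def
  proof (intro exI[of _ "cos_prod_grad m"] exI[of _ "cos_prod_hess m"] conjI ballI allI impI)
    show "(cos_prod m has_derivative (\<bullet>) (cos_prod_grad m x)) (at x within S)" for x S
      by (rule has_derivative_at_withinI) (rule has_derivative_cos_prod)
    show "continuous_on S (cos_prod_grad m)" for S by (rule continuous_on_cos_prod_grad)
    show "continuous_on S (cos_prod_hess m)" for S by (rule continuous_on_cos_prod_hess)
    show "(cos_prod_grad m has_derivative blinfun_apply (cos_prod_hess m x)) (at x)" for x
      unfolding blinfun_apply_cos_prod_hess by (rule has_derivative_cos_prod_grad)
    show "(\<Sum>b\<in>Basis. blinfun_apply (cos_prod_hess m x) b \<bullet> b) + (\<Sum>j\<in>UNIV. (m $ j)\<^sup>2) * cos_prod m x = 0" for x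
      by (simp add: sum_Basis_cart cos_prod_hess_diag sum_distrib_right sum_negf)
    fix x n assume "outward_unit_normal (centered_box a) x n"
    then obtain j s where s: "s = 1 \<or> s = -1" "x $ j = s * a $ j" "n = axis j s"
      using outward_unit_normal_box[OF a] by blast
    have c: "cos (m $ j * a $ j) = \<beta> * m $ j * sin (m $ j * a $ j)"
      using m by (simp add: robin_freq_def)
    show "\<beta> * (cos_prod_grad m x \<bullet> n) + cos_prod m x = 0"
      using s(1) unfolding s(3) inner_axis inner_real_def
      unfolding cos_prod_split(1)[of m x j] cos_prod_split(2)[of m x j] s(2)
      by (auto simp: c)
  qed
  moreover have "cos_prod m 0 \<noteq> 0" by (simp add: cos_prod_def cos_factor_def)
  ultimately show ?thesis
    unfolding robin_eigenvalue_def using centered_box_facts(4)[OF a] by blast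
qed

section \<open>The maximum principle\<close>

lemma has_derivative_max_le_0:
  fixes F :: "'a::real_normed_vector \<Rightarrow> real"
  assumes "convex S" "x \<in> S" "y \<in> S" and der: "(F has_derivative D) (at x within S)"
    and max: "\<And>z. z \<in> S \<Longrightarrow> F z \<le> F x"
  shows "D (y - x) \<le> 0"
proof (rule ccontr)
  assume "\<not> ?thesis"
  hence pos: "0 < D (y - x)" by simp
  let ?c = "\<lambda>t::real. x + t *\<^sub>R (y - x)"
  have sub: "?c ` {0..1} \<subseteq> S"
  proof clarify
    fix t :: real assume "t \<in> {0..1}"
    hence "(1 - t) *\<^sub>R x + t *\<^sub>R y \<in> S" using assms(1-3) by (intro convexD) auto
    thus "x + t *\<^sub>R (y - x) \<in> S" by (simp add: algebra_simps)
  qed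
  have "(?c has_derivative (\<lambda>t. t *\<^sub>R (y - x))) (at 0 within {0..1})"
    by (auto intro!: derivative_eq_intros)
  moreover have "(F has_derivative D) (at (?c 0) within ?c ` {0..1})"
    using has_derivative_subset[OF der sub] by simp
  ultimately have "((F \<circ> ?c) has_derivative (D \<circ> (\<lambda>t. t *\<^sub>R (y - x)))) (at 0 within {0..1})"
    by (rule diff_chain_within)
  moreover have "D \<circ> (\<lambda>t. t *\<^sub>R (y - x)) = (\<lambda>t. D (y - x) * t)"
    using linear_cmul[OF has_derivative_linear[OF der]] by (auto simp: fun_eq_iff)
  ultimately have "((F \<circ> ?c) has_real_derivative D (y - x)) (at 0 within {0..1})"
    by (simp add: has_field_derivative_def)
  from has_real_derivative_pos_inc_right[OF this pos]
  obtain d where d: "d > 0" "\<And>h. 0 < h \<Longrightarrow> h \<in> {0..1} \<Longrightarrow> h < d \<Longrightarrow> F x < F (?c h)"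
    by auto
  define t where "t = min 1 (d / 2)"
  have t: "0 < t" "t \<in> {0..1}" "t < d" using d(1) by (auto simp: t_def)
  have "?c t \<in> S" using sub t(2) by blast
  thus False using d(2)[OF t] max[of "?c t"] by simp
qed

lemma second_derivative_max_le_0:
  fixes F :: "'a::real_inner \<Rightarrow> real" and G :: "'a \<Rightarrow> 'a"
  assumes S: "open S" "x \<in> S"
    and F: "\<And>z. z \<in> S \<Longrightarrow> (F has_derivative (\<lambda>v. G z \<bullet> v)) (at z)"
    and G: "(G has_derivative D) (at x)"
    and max: "\<And>z. z \<in> S \<Longrightarrow> F z \<le> F x"
  shows "D v \<bullet> v \<le> 0"
proof (rule ccontr)
  assume "\<not> ?thesis"
  hence pos: "0 < D v \<bullet> v" by simp
  let ?c = "\<lambda>t::real. x + t *\<^sub>R v"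
  have c: "(?c has_derivative (\<lambda>h. h *\<^sub>R v)) (at t)" for t
    by (auto intro!: derivative_eq_intros)
  have "(\<lambda>v. G x \<bullet> v) = (\<lambda>v. 0)"
    using max by (intro differential_zero_maxmin[OF S(2,1) F[OF S(2)]]) auto
  hence G0: "G x \<bullet> v = 0" by meson
  have "((\<lambda>t. G (?c t)) has_derivative (\<lambda>h. D (h *\<^sub>R v))) (at 0)"
    using has_derivative_compose[OF c[of 0], of G D] G by simp
  hence "((\<lambda>t. G (?c t) \<bullet> v) has_derivative (\<lambda>h. D (h *\<^sub>R v) \<bullet> v)) (at 0)"
    by (rule has_derivative_inner_left)
  moreover have "(\<lambda>h. D (h *\<^sub>R v) \<bullet> v) = (\<lambda>h. (D v \<bullet> v) * h)"
    using linear_cmul[OF has_derivative_linear[OF G]] by (auto simp: fun_eq_iff)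
  ultimately have "((\<lambda>t. G (?c t) \<bullet> v) has_real_derivative (D v \<bullet> v)) (at 0)"
    by (simp add: has_field_derivative_def)
  from DERIV_pos_inc_right[OF this pos] G0
  obtain d where d: "d > 0" "\<And>h. 0 < h \<Longrightarrow> h < d \<Longrightarrow> 0 < G (?c h) \<bullet> v" by auto
  have "continuous_on UNIV ?c" by (intro continuous_intros)
  hence "open (?c -` S)" using S(1) by (simp add: continuous_open_vimage)
  moreover have "0 \<in> ?c -` S" using S(2) by simp
  ultimately obtain e where e: "e > 0" "ball 0 e \<subseteq> ?c -` S" by (metis openE)
  define r where "r = min d e / 2"
  have r: "0 < r" "r < d" "r < e" using d(1) e(1) by (auto simp: r_def)
  have inS: "?c t \<in> S" if "0 \<le> t" "t \<le> r" for t
    using e(2) that r by (auto simp: subset_iff dist_norm)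
  have der: "((\<lambda>t. F (?c t)) has_real_derivative (G (?c t) \<bullet> v)) (at t)" if "0 \<le> t" "t \<le> r" for t
    using has_derivative_compose[OF c[of t] F[OF inS[OF that]]]
    by (simp add: has_field_derivative_def mult.commute[of _ "_ \<bullet> _"])
  from MVT2[OF r(1) der]
  obtain z where z: "0 < z" "z < r" "F (?c r) - F (?c 0) = (r - 0) * (G (?c z) \<bullet> v)" by auto
  have "0 < F (?c r) - F x" using z d(2)[of z] r by simp
  thus False using max[OF inS[of r]] r by simp
qed

text \<open>
  Edges and corners carry no normal, and the boundary condition says nothing there. But such a
  point is a limit of relative interior points of each face through it, so the condition extends,
  with the normal of the face, by continuity of the gradient up to the boundary.
\<close>

lemma robin_condition_closed_faces:
  fixes a :: "real ^ 'n"
  assumes a: "\<And>j. a $ j > 0" and s: "s = 1 \<or> s = -1"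
    and u: "continuous_on (cbox (- a) a) u" and g: "continuous_on (cbox (- a) a) g"
    and bc: "\<And>x n. outward_unit_normal (centered_box a) x n \<Longrightarrow> \<beta> * (g x \<bullet> n) + u x = 0"
    and x: "x \<in> cbox (- a) a" "x $ j = s * a $ j"
  shows "\<beta> * (g x \<bullet> axis j s) + u x = 0"
proof -
  \<comment> \<open>a segment from \<open>x\<close> to the centre of the face\<close>
  define y where "y t = x + t *\<^sub>R (axis j (s * a $ j) - x)" for t :: real
  have yj: "y t $ j = s * a $ j" for t using x(2) by (simp add: y_def)
  have yk: "\<bar>y t $ k\<bar> = \<bar>1 - t\<bar> * \<bar>x $ k\<bar>" if "k \<noteq> j" for k t
  proof -
    have "y t $ k = (1 - t) * x $ k" using that by (simp add: y_def axis_def algebra_simps)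
    thus ?thesis by (simp add: abs_mult)
  qed
  have xk: "\<bar>x $ k\<bar> \<le> a $ k" for k using x(1) by (simp add: cbox_sym_cart)
  have lt: "\<bar>y t $ k\<bar> < a $ k" if "0 < t" "t \<le> 1" "k \<noteq> j" for k t
  proof -
    have "\<bar>1 - t\<bar> * \<bar>x $ k\<bar> \<le> \<bar>1 - t\<bar> * a $ k" using xk by (intro mult_left_mono) auto
    also have "\<dots> < a $ k" using that a[of k] by simp
    finally show ?thesis using yk[OF that(3)] by simp
  qed
  have bcy: "\<beta> * (g (y t) \<bullet> axis j s) + u (y t) = 0" if "0 < t" "t \<le> 1" for t
    by (rule bc, rule outward_unit_normal_face[OF a s yj lt[OF that]])
  have incl: "y t \<in> cbox (- a) a" if "t \<in> {0..1}" for t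
    unfolding cbox_sym_cart
  proof
    fix k
    show "\<bar>y t $ k\<bar> \<le> a $ k"
    proof (cases "k = j")
      case True
      thus ?thesis using yj[of t] s a[of j] by (auto simp: abs_mult)
    next
      case False
      thus ?thesis using lt[of t k] xk[of k] that by (cases "t = 0") (auto simp: y_def)
    qed
  qed
  have cy: "continuous_on {0..1} y" unfolding y_def by (intro continuous_intros)
  have "continuous_on {0..1} (\<lambda>t. \<beta> * (g (y t) \<bullet> axis j s) + u (y t))"
    by (intro continuous_intros continuous_on_compose2[OF g cy] continuous_on_compose2[OF u cy])
       (use incl in auto)
  hence "((\<lambda>t. \<beta> * (g (y t) \<bullet> axis j s) + u (y t)) \<longlongrightarrow> \<beta> * (g (y 0) \<bullet> axis j s) + u (y 0)) (at 0 within {0..1})"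
    by (simp add: continuous_on_def)
  moreover have "((\<lambda>t. \<beta> * (g (y t) \<bullet> axis j s) + u (y t)) \<longlongrightarrow> 0) (at 0 within {0..1})"
    by (rule tendsto_eventually) (auto simp: eventually_at_filter bcy)
  moreover have "at (0::real) within {0..1} \<noteq> bot"
    by (simp add: at_within_Icc_at_right)
  ultimately have "\<beta> * (g (y 0) \<bullet> axis j s) + u (y 0) = 0"
    by (rule tendsto_unique[rotated])
  thus ?thesis by (simp add: y_def)
qed

lemma robin_solution_uminus:
  assumes "robin_solution \<beta> \<Omega> \<Lambda> u"
  shows "robin_solution \<beta> \<Omega> \<Lambda> (\<lambda>x. - u x)"
proof -
  from assms obtain g H where *:
    "\<And>x. x \<in> closure \<Omega> \<Longrightarrow> (u has_derivative (\<lambda>v. g x \<bullet> v)) (at x within closure \<Omega>)"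
    "continuous_on (closure \<Omega>) g"
    "\<And>x. x \<in> \<Omega> \<Longrightarrow> (g has_derivative blinfun_apply (H x)) (at x)"
    "continuous_on \<Omega> H"
    "\<And>x. x \<in> \<Omega> \<Longrightarrow> (\<Sum>b\<in>Basis. blinfun_apply (H x) b \<bullet> b) + \<Lambda> * u x = 0"
    "\<And>x n. outward_unit_normal \<Omega> x n \<Longrightarrow> \<beta> * (g x \<bullet> n) + u x = 0"
    unfolding robin_solution_def by blast
  show ?thesis unfolding robin_solution_def
  proof (intro exI[of _ "\<lambda>x. - g x"] exI[of _ "\<lambda>x. - H x"] conjI ballI allI impI)
    fix x assume x: "x \<in> \<Omega>"
    show "((\<lambda>x. - g x) has_derivative blinfun_apply (- H x)) (at x)"
      using has_derivative_minus[OF *(3)[OF x]] by (simp add: uminus_blinfun.rep_eq)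
    show "(\<Sum>b\<in>Basis. blinfun_apply (- H x) b \<bullet> b) + \<Lambda> * - u x = 0"
      using *(5)[OF x] by (simp add: uminus_blinfun.rep_eq sum_negf)
  next
    fix x n assume "outward_unit_normal \<Omega> x n"
    from *(6)[OF this] show "\<beta> * (- g x \<bullet> n) + - u x = 0" by simp
  next
    fix x assume "x \<in> closure \<Omega>"
    from has_derivative_minus[OF *(1)[OF this]]
    show "((\<lambda>x. - u x) has_derivative (\<bullet>) (- g x)) (at x within closure \<Omega>)"
      by (rule has_derivative_eq_rhs) (simp add: fun_eq_iff)
  qed (use * in \<open>auto intro: continuous_intros\<close>)
qed

text \<open>
  Comparison with the supersolution \<open>\<phi> = cos_prod \<nu>\<close>, which is positive on the closed box. If \<open>u\<close> is
  positive somewhere, then \<open>u / \<phi>\<close> has a positive maximum \<open>M\<close> on the closed box, and \<open>F = u - M \<phi>\<close>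
  attains its maximum \<open>0\<close> at the same point \<open>x0\<close>. At an interior point, the Laplacian of \<open>F\<close> would be
  \<open>M \<phi> (\<Sum>\<nu>\<^sub>j\<^sup>2 - \<Lambda>) > 0\<close>. On a face with normal \<open>n\<close>, maximality gives \<open>\<partial>F/\<partial>n \<ge> 0\<close>, while the boundary
  condition of \<open>u\<close> and the strict one of \<open>\<phi>\<close> give \<open>\<beta> \<partial>F/\<partial>n = - M (\<phi> + \<beta> \<partial>\<phi>/\<partial>n) < 0\<close>.
\<close>

lemma robin_solution_nonpos:
  fixes a \<nu> :: "real ^ 'n"
  assumes a: "\<And>j. a $ j > 0" and \<beta>: "\<beta> \<ge> 0"
    and \<nu>: "\<And>j. 0 \<le> \<nu> $ j" "\<And>j. \<nu> $ j * a $ j < pi / 2"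
    and def: "\<And>j. \<beta> * \<nu> $ j * sin (\<nu> $ j * a $ j) < cos (\<nu> $ j * a $ j)"
    and \<Lambda>: "\<Lambda> < (\<Sum>j\<in>UNIV. (\<nu> $ j)\<^sup>2)"
    and u: "robin_solution \<beta> (centered_box a) \<Lambda> u" and x: "x \<in> centered_box a"
  shows "u x \<le> 0"
proof (rule ccontr)
  assume ux: "\<not> u x \<le> 0"
  let ?K = "cbox (- a) a" and ?\<Omega> = "centered_box a" and ?\<phi> = "cos_prod \<nu>"
  have cl: "closure ?\<Omega> = ?K" using a by (rule centered_box_facts)
  from u obtain g H where
    du: "\<And>x. x \<in> ?K \<Longrightarrow> (u has_derivative (\<lambda>v. g x \<bullet> v)) (at x within ?K)" and
    cg: "continuous_on ?K g" and
    dg: "\<And>x. x \<in> ?\<Omega> \<Longrightarrow> (g has_derivative blinfun_apply (H x)) (at x)" and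
    pde: "\<And>x. x \<in> ?\<Omega> \<Longrightarrow> (\<Sum>b\<in>Basis. blinfun_apply (H x) b \<bullet> b) + \<Lambda> * u x = 0" and
    bc: "\<And>x n. outward_unit_normal ?\<Omega> x n \<Longrightarrow> \<beta> * (g x \<bullet> n) + u x = 0"
    unfolding robin_solution_def cl by blast
  have cu: "continuous_on ?K u"
    using du by (meson has_derivative_continuous continuous_on_eq_continuous_within)
  have cpos: "0 < cos (\<nu> $ k * y $ k)" if "y \<in> ?K" for y k
  proof -
    have "\<bar>\<nu> $ k * y $ k\<bar> \<le> \<nu> $ k * a $ k"
      using that \<nu>(1)[of k] by (auto simp: cbox_sym_cart abs_mult intro!: mult_left_mono)
    also have "\<dots> < pi / 2" by (rule \<nu>)
    finally show ?thesis by (intro cos_gt_zero_pi) auto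
  qed
  have \<phi>pos: "0 < ?\<phi> y" if "y \<in> ?K" for y
    unfolding cos_prod_def cos_factor_def using cpos[OF that] by (intro prod_pos) auto
  have c\<phi>: "continuous_on ?K ?\<phi>"
    by (meson has_derivative_cos_prod continuous_at_imp_continuous_on has_derivative_continuous)
  have "continuous_on ?K (\<lambda>y. u y / ?\<phi> y)"
    using cu c\<phi> \<phi>pos by (intro continuous_on_divide) (auto simp: less_imp_neq[symmetric] order_less_imp_not_eq2)
  moreover have xK: "x \<in> ?K" using x closure_subset[of ?\<Omega>] cl by auto
  ultimately obtain x0 where x0: "x0 \<in> ?K" "\<And>y. y \<in> ?K \<Longrightarrow> u y / ?\<phi> y \<le> u x0 / ?\<phi> x0"
    using continuous_attains_sup[OF compact_cbox, of "- a" a "\<lambda>y. u y / ?\<phi> y"] by blast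
  define M where "M = u x0 / ?\<phi> x0"
  have "0 < u x / ?\<phi> x" using ux \<phi>pos[OF xK] by simp
  hence M: "0 < M" using x0(2)[OF xK] by (simp add: M_def)
  define F where "F y = u y - M * ?\<phi> y" for y
  define G where "G y = g y - M *\<^sub>R cos_prod_grad \<nu> y" for y
  have ux0: "u x0 = M * ?\<phi> x0" using \<phi>pos[OF x0(1)] by (simp add: M_def)
  have Fmax: "F y \<le> F x0" if "y \<in> ?K" for y
    using x0(2)[OF that] unfolding M_def[symmetric] F_def
    by (simp add: pos_divide_le_eq[OF \<phi>pos[OF that]] ux0)
  have dF: "(F has_derivative (\<lambda>v. G y \<bullet> v)) (at y within ?K)" if "y \<in> ?K" for y
  proof -
    have "(F has_derivative (\<lambda>v. g y \<bullet> v - M * (cos_prod_grad \<nu> y \<bullet> v))) (at y within ?K)"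
      unfolding F_def
      by (intro has_derivative_diff du[OF that] has_derivative_mult_right
          has_derivative_at_withinI[OF has_derivative_cos_prod])
    thus ?thesis by (simp add: G_def inner_diff_left)
  qed
  show False
  proof (cases "x0 \<in> ?\<Omega>")
    case True
    define D where "D v = blinfun_apply (H x0) v - M *\<^sub>R blinfun_apply (cos_prod_hess \<nu> x0) v" for v
    have "(cos_prod_grad \<nu> has_derivative blinfun_apply (cos_prod_hess \<nu> x0)) (at x0)"
      unfolding blinfun_apply_cos_prod_hess by (rule has_derivative_cos_prod_grad)
    hence dG: "(G has_derivative D) (at x0)"
      unfolding G_def D_def
      by (intro has_derivative_diff dg[OF True] has_derivative_scaleR_right)
    have dF': "(F has_derivative (\<lambda>v. G y \<bullet> v)) (at y)" if "y \<in> ?\<Omega>" for y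
    proof -
      have "y \<in> interior ?K" using that interior_cbox[of "- a" a] by (simp add: centered_box_eq)
      thus ?thesis using dF[of y] by (metis at_within_interior interior_subset subsetD)
    qed
    have "D v \<bullet> v \<le> 0" for v
    proof (rule second_derivative_max_le_0[OF _ True dF' dG])
      show "open ?\<Omega>" using a by (rule centered_box_facts)
      show "F z \<le> F x0" if "z \<in> ?\<Omega>" for z
        using Fmax[of z] that closure_subset[of ?\<Omega>] cl by auto
    qed
    hence "(\<Sum>b\<in>Basis. D b \<bullet> b) \<le> 0" by (intro sum_nonpos) auto
    moreover have "(\<Sum>b\<in>Basis. D b \<bullet> b) = (\<Sum>b\<in>Basis. blinfun_apply (H x0) b \<bullet> b)
        - M * (\<Sum>b\<in>Basis. blinfun_apply (cos_prod_hess \<nu> x0) b \<bullet> b)"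
      by (simp add: D_def inner_diff_left sum_subtractf sum_distrib_left)
    moreover have "(\<Sum>b\<in>Basis. blinfun_apply (cos_prod_hess \<nu> x0) b \<bullet> b) =
        - (\<Sum>j\<in>UNIV. (\<nu> $ j)\<^sup>2) * ?\<phi> x0"
      by (simp add: sum_Basis_cart cos_prod_hess_diag sum_distrib_right sum_negf)
    ultimately have "((\<Sum>j\<in>UNIV. (\<nu> $ j)\<^sup>2) - \<Lambda>) * (M * ?\<phi> x0) \<le> 0"
      using pde[OF True] ux0 by (simp add: algebra_simps)
    moreover have "0 < ((\<Sum>j\<in>UNIV. (\<nu> $ j)\<^sup>2) - \<Lambda>) * (M * ?\<phi> x0)"
      using \<Lambda> M \<phi>pos[OF x0(1)] by simp
    ultimately show False by simp
  next
    case False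
    then obtain j where j: "\<not> (- a $ j < x0 $ j \<and> x0 $ j < a $ j)" by (auto simp: centered_box_def)
    moreover have "- a $ j \<le> x0 $ j \<and> x0 $ j \<le> a $ j" using x0(1) by (auto simp: mem_box_cart)
    ultimately obtain s :: real where s: "s = 1 \<or> s = -1" "x0 $ j = s * a $ j"
      by (metis mult_1 mult_minus1 order_le_less)
    \<comment> \<open>one-sided differentiation from \<open>x0\<close> inwards, along the normal of the face\<close>
    define y where "y = x0 - a $ j *\<^sub>R axis j s"
    have "\<bar>y $ k\<bar> \<le> a $ k" for k
      using x0(1) s by (cases "k = j") (auto simp: y_def axis_def cbox_sym_cart less_imp_le[OF a])
    hence yK: "y \<in> ?K" by (simp add: cbox_sym_cart)
    have "G x0 \<bullet> (y - x0) \<le> 0"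
      by (rule has_derivative_max_le_0[OF _ x0(1) yK dF[OF x0(1)] Fmax]) (rule convex_box)
    hence "0 \<le> a $ j * (G x0 \<bullet> axis j s)" by (simp add: y_def)
    hence G0: "0 \<le> G x0 \<bullet> axis j s" using a[of j] by (simp add: zero_le_mult_iff)
    have b: "\<beta> * (g x0 \<bullet> axis j s) + u x0 = 0"
      by (rule robin_condition_closed_faces[OF a s(1) cu cg bc x0(1) s(2)])
    define P where "P = (\<Prod>l\<in>UNIV-{j}. cos (\<nu> $ l * x0 $ l))"
    have P: "0 < P" unfolding P_def using cpos[OF x0(1)] by (intro prod_pos) auto
    have \<phi>: "?\<phi> x0 = cos (\<nu> $ j * a $ j) * P"
      using s unfolding P_def cos_prod_split(2)[of \<nu> x0 j] by auto
    have "cos_prod_grad \<nu> x0 \<bullet> axis j s = - \<nu> $ j * sin (\<nu> $ j * a $ j) * P"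
      using s unfolding P_def inner_axis cos_prod_split(1)[of \<nu> x0 j] by auto
    hence "G x0 \<bullet> axis j s = g x0 \<bullet> axis j s + M * (\<nu> $ j * sin (\<nu> $ j * a $ j) * P)"
      by (simp add: G_def inner_diff_left)
    hence "0 \<le> \<beta> * (g x0 \<bullet> axis j s + M * (\<nu> $ j * sin (\<nu> $ j * a $ j) * P))"
      using G0 \<beta> by simp
    hence "0 \<le> M * P * (\<beta> * \<nu> $ j * sin (\<nu> $ j * a $ j) - cos (\<nu> $ j * a $ j))"
      using b ux0 \<phi> by (simp add: algebra_simps)
    thus False using mult_pos_pos[OF M P] def[of j] by (auto simp: zero_le_mult_iff)
  qed
qed

text \<open>
  If \<open>\<Lambda>\<close> were smaller than \<open>\<Sum>m\<^sub>j\<^sup>2\<close>, it would still be smaller than \<open>\<Sum>(t m\<^sub>j)\<^sup>2\<close> for some \<open>t < 1\<close> near 1,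
  and the comparison lemma applied to \<open>u\<close> and \<open>- u\<close> would force \<open>u = 0\<close>.
\<close>

lemma robin_eigenvalue_ge:
  fixes a m :: "real ^ 'n"
  assumes \<beta>: "\<beta> \<ge> 0" and a: "\<And>j. a $ j > 0" and m: "\<And>j. robin_freq \<beta> (a $ j) (m $ j)"
    and ev: "robin_eigenvalue \<beta> (centered_box a) \<Lambda>"
  shows "(\<Sum>j\<in>UNIV. (m $ j)\<^sup>2) \<le> \<Lambda>"
proof (rule ccontr)
  assume "\<not> ?thesis"
  hence lt: "\<Lambda> < (\<Sum>j\<in>UNIV. (m $ j)\<^sup>2)" by simp
  have "((\<lambda>t::real. \<Sum>j\<in>UNIV. (t * m $ j)\<^sup>2) \<longlongrightarrow> (\<Sum>j\<in>UNIV. (1 * m $ j)\<^sup>2)) (at_left 1)"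
    by (intro tendsto_intros)
  hence "\<forall>\<^sub>F t in at_left 1. \<Lambda> < (\<Sum>j\<in>UNIV. (t * m $ j)\<^sup>2)"
    using lt by (intro order_tendstoD) auto
  moreover have "\<forall>\<^sub>F t in at_left (1::real). t \<in> {0<..<1}"
    by (rule eventually_at_left_real) simp
  ultimately have "\<forall>\<^sub>F t in at_left (1::real). \<Lambda> < (\<Sum>j\<in>UNIV. (t * m $ j)\<^sup>2) \<and> t \<in> {0<..<1}"
    by eventually_elim simp
  then obtain t :: real where t: "\<Lambda> < (\<Sum>j\<in>UNIV. (t * m $ j)\<^sup>2)" "0 < t" "t < 1"
    using eventually_happens'[OF trivial_limit_at_left_real] by fastforce
  define \<nu> where "\<nu> = t *\<^sub>R m"
  have mpos: "0 < m $ j" "m $ j * a $ j \<le> pi / 2" for j using m[of j] by (auto simp: robin_freq_def)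
  have \<nu>: "0 \<le> \<nu> $ j" "\<nu> $ j < m $ j" for j
    using t mpos[of j] by (auto simp: \<nu>_def)
  have \<nu>2: "\<nu> $ j * a $ j < pi / 2" for j
    using \<nu>(2)[of j] a[of j] mpos(2)[of j] by (meson mult_strict_right_mono order_less_le_trans)
  have def: "\<beta> * \<nu> $ j * sin (\<nu> $ j * a $ j) < cos (\<nu> $ j * a $ j)" for j
    by (rule robin_defect_pos[OF \<beta> a m \<nu>])
  have \<Lambda>: "\<Lambda> < (\<Sum>j\<in>UNIV. (\<nu> $ j)\<^sup>2)" using t by (simp add: \<nu>_def)
  from ev obtain u x where u: "robin_solution \<beta> (centered_box a) \<Lambda> u" "x \<in> centered_box a" "u x \<noteq> 0"
    unfolding robin_eigenvalue_def by blast
  have "u x \<le> 0" by (rule robin_solution_nonpos[OF a \<beta> \<nu>(1) \<nu>2 def \<Lambda> u(1,2)])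
  moreover have "- u x \<le> 0"
    by (rule robin_solution_nonpos[OF a \<beta> \<nu>(1) \<nu>2 def \<Lambda> robin_solution_uminus[OF u(1)] u(2)])
  ultimately show False using u(3) by simp
qed

lemma robin_lambda1_box:
  fixes a m :: "real ^ 'n"
  assumes "\<beta> \<ge> 0" and "\<And>j. a $ j > 0" and "\<And>j. robin_freq \<beta> (a $ j) (m $ j)"
  shows "robin_lambda1 \<beta> (centered_box a) = (\<Sum>j\<in>UNIV. (m $ j)\<^sup>2)"
  unfolding robin_lambda1_def
  using robin_eigenvalue_cos_prod[OF assms(2,3)] robin_eigenvalue_ge[OF assms]
  by (intro Least_equality) auto

section \<open>The cube minimises the fundamental eigenvalue\<close>

theorem theorem6:
  fixes \<beta> h :: real and a :: "real ^ 'n"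
  assumes "\<beta> \<ge> 0"
    and "h > 0"
    and "\<And>j. a $ j > 0"
    and "(\<Prod>j\<in>UNIV. a $ j) = h ^ CARD('n)"
  shows "robin_lambda1 \<beta> (centered_box a) \<ge> robin_lambda1 \<beta> (centered_box ((\<chi> j. h) :: real ^ 'n))"
proof -
  obtain m0 where m0: "robin_freq \<beta> h m0" using robin_freq_exists assms by blast
  define m :: "real ^ 'n" where "m = (\<chi> j. SOME \<mu>. robin_freq \<beta> (a $ j) \<mu>)"
  have m: "robin_freq \<beta> (a $ j) (m $ j)" for j
    using someI_ex[OF robin_freq_exists[OF assms(1,3)]] by (simp add: m_def)
  obtain k where k: "\<And>c n. c > 0 \<Longrightarrow> robin_freq \<beta> c n \<Longrightarrow> m0\<^sup>2 - k * (ln c - ln h) \<le> n\<^sup>2"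
    using robin_freq_tangent[OF assms(1,2) m0] by blast
  have "ln (\<Prod>j\<in>UNIV. a $ j) = (\<Sum>j\<in>UNIV. ln (a $ j))"
    by (intro ln_prod) (use assms(3) in \<open>auto simp: order_less_imp_not_eq2\<close>)
  hence vol: "(\<Sum>j\<in>UNIV. ln (a $ j)) = CARD('n) * ln h"
    using assms(2,4) by (simp add: ln_realpow)
  have "robin_lambda1 \<beta> (centered_box ((\<chi> j. h) :: real ^ 'n)) = (\<Sum>j\<in>(UNIV::'n set). m0\<^sup>2)"
    using robin_lambda1_box[of \<beta> "\<chi> j. h" "\<chi> j. m0"] assms m0 by simp
  also have "\<dots> = (\<Sum>j\<in>UNIV. m0\<^sup>2 - k * (ln (a $ j) - ln h))"
    by (simp add: sum_subtractf sum_distrib_left[symmetric] vol)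
  also have "\<dots> \<le> (\<Sum>j\<in>UNIV. (m $ j)\<^sup>2)"
    by (intro sum_mono k assms m)
  also have "\<dots> = robin_lambda1 \<beta> (centered_box a)"
    using robin_lambda1_box[OF assms(1,3) m] by simp
  finally show ?thesis .
qed

end
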